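(* Let $\{c_n\}_{n=1}^{\infty}$ be a sequence of real numbers and let $\{d_n\}_{n=1}^{\infty}$ be a positive chain sequence with minimal parameter sequence $\{m_n\}_{n=0}^{\infty}$. Let $\{R_n\}_{n\ge0}$ be the polynomials given by $R_0(z)=1$, $R_1(z)=(1+ic_1)z+(1-ic_1)$ and \[ R_{n+1}(z)=[(1+ic_{n+1})z+(1-ic_{n+1})]R_n(z)-4d_{n+1}zR_{n-1}(z),\qquad n\ge1, \] and let $\mu$ be the nontrivial probability measure on the unit circle associated with $\{c_n\}$ and $\{d_n\}$ (defined in the context). If the sequence of polynomials $\{S_n\}_{n\ge0}$ is such that $S_0(z)=1$ and \[ S_n(z)\prod_{k=1}^{n}(1+ic_k)=R_n(z)-2(1-m_n)R_{n-1}(z),\qquad n\ge1, \] then $\{S_n\}$ is the sequence of monic orthogonal polynomials on the unit circle with respect to the measure $\mu$.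
   Context: A sequence $\{d_n\}_{n=1}^{\infty}$ is a positive chain sequence if there is a sequence $\{g_n\}_{n=0}^{\infty}$ (a parameter sequence) with $0\le g_0<1$, $0<g_n<1$ for $n\ge1$, and $d_n=(1-g_{n-1})g_n$ for all $n\ge1$. The minimal parameter sequence $\{m_n\}_{n=0}^{\infty}$ is the parameter sequence with $m_0=0$. The polynomials $Q_n$ are defined by $Q_0(z)=0$, $Q_1(z)=2d_1$ and $Q_{n+1}(z)=[(1+ic_{n+1})z+(1-ic_{n+1})]Q_n(z)-4d_{n+1}zQ_{n-1}(z)$ for $n\ge1$. There are unique formal series $E_0(z)=-\nu_1-\nu_2z-\nu_3z^2-\cdots$ and $E_\infty(z)=\frac{\nu_0}{z}+\frac{\nu_{-1}}{z^2}+\frac{\nu_{-2}}{z^3}+\cdots$ such that, for every $n\ge0$, $E_0(z)-\frac{Q_n(z)}{R_n(z)}=O(z^n)$ (expanding about the origin) and $E_\infty(z)-\frac{Q_n(z)}{R_n(z)}=O\big((1/z)^{n+1}\big)$ (expanding about infinity). This defines the double sequence of complex numbers $\{\nu_n\}_{n=-\infty}^{\infty}$. The measure $\mu$ associated with $\{c_n\}$ and $\{d_n\}$ is the (unique) nontrivial probability measure on $\mathcal{C}=\{\zeta\in\mathbb{C}:|\zeta|=1\}$ satisfying $\int_{\mathcal{C}}\zeta^{-n}(1-\zeta)\,d\mu(\zeta)=\nu_n$ for all $n=0,\pm1,\pm2,\ldots$. Nontrivial means that its support is infinite. The monic orthogonal polynomials on the unit circle with respect to $\mu$ are the monic polynomials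 $S_n$ of degree $n$, $n\geq 0$, with $\int_{\mathcal{C}}\overline{S_m(\zeta)}S_n(\zeta)\,d\mu(\zeta)=0$ for $m\ne n$. *)

theory Defs
  imports
    "HOL-Probability.Probability"
    "HOL-Computational_Algebra.Computational_Algebra"
begin

text \<open>
  The sequences \<open>c\<close> and \<open>d\<close> are indexed from 1; the values \<open>c 0\<close> and \<open>d 0\<close> are never used.
\<close>

definition parameter_sequence :: "(nat \<Rightarrow> real) \<Rightarrow> (nat \<Rightarrow> real) \<Rightarrow> bool" where
  "parameter_sequence d g \<longleftrightarrow>
     0 \<le> g 0 \<and> g 0 < 1 \<and> (\<forall>n\<ge>1. 0 < g n \<and> g n < 1) \<and>
     (\<forall>n\<ge>1. d n = (1 - g (n - 1)) * g n)"

definition positive_chain_sequence :: "(nat \<Rightarrow> real) \<Rightarrow> bool" where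
  "positive_chain_sequence d \<longleftrightarrow> (\<exists>g. parameter_sequence d g)"

definition minimal_parameter_sequence :: "(nat \<Rightarrow> real) \<Rightarrow> (nat \<Rightarrow> real) \<Rightarrow> bool" where
  "minimal_parameter_sequence d m \<longleftrightarrow> parameter_sequence d m \<and> m 0 = 0"

fun R :: "(nat \<Rightarrow> real) \<Rightarrow> (nat \<Rightarrow> real) \<Rightarrow> nat \<Rightarrow> complex poly" where
  "R c d 0 = 1"
| "R c d (Suc 0) = [:1 - \<i> * of_real (c 1), 1 + \<i> * of_real (c 1):]"
| "R c d (Suc (Suc n)) =
     [:1 - \<i> * of_real (c (n + 2)), 1 + \<i> * of_real (c (n + 2)):] * R c d (Suc n)
     - [:0, 4 * of_real (d (n + 2)):] * R c d n"

fun Q :: "(nat \<Rightarrow> real) \<Rightarrow> (nat \<Rightarrow> real) \<Rightarrow> nat \<Rightarrow> complex poly" where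
  "Q c d 0 = 0"
| "Q c d (Suc 0) = [:2 * of_real (d 1):]"
| "Q c d (Suc (Suc n)) =
     [:1 - \<i> * of_real (c (n + 2)), 1 + \<i> * of_real (c (n + 2)):] * Q c d (Suc n)
     - [:0, 4 * of_real (d (n + 2)):] * Q c d n"

text \<open>
  The rational function \<open>p/q\<close> with the formal Laurent series \<open>u\<close> substituted for \<open>z\<close>. Taking
  \<open>u = fls_X\<close> gives the expansion about the origin in powers of \<open>z\<close>, and \<open>u = fls_X_inv\<close>
  the expansion about infinity in powers of \<open>1/z\<close>.
\<close>
definition rational_expansion ::
    "complex poly \<Rightarrow> complex poly \<Rightarrow> complex fls \<Rightarrow> complex fls" where
  "rational_expansion p q u =
     poly (map_poly fls_const p) u / poly (map_poly fls_const q) u"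

text \<open>\<open>F = O(X\<^sup>n)\<close> for a formal Laurent series in \<open>X\<close>.\<close>
definition fls_order_ge :: "complex fls \<Rightarrow> nat \<Rightarrow> bool" where
  "fls_order_ge F n \<longleftrightarrow> (\<forall>k < int n. fls_nth F k = 0)"

text \<open>\<open>E\<^sub>0(z) = - \<nu>\<^sub>1 - \<nu>\<^sub>2 z - \<nu>\<^sub>3 z\<^sup>2 - \<dots>\<close>, a series in \<open>z\<close>\<close>
definition E_zero :: "(int \<Rightarrow> complex) \<Rightarrow> complex fls" where
  "E_zero \<nu> = fps_to_fls (Abs_fps (\<lambda>k. - \<nu> (int k + 1)))"

text \<open>\<open>E\<^sub>\<infinity>(z) = \<nu>\<^sub>0/z + \<nu>\<^sub>-\<^sub>1/z\<^sup>2 + \<nu>\<^sub>-\<^sub>2/z\<^sup>3 + \<dots>\<close>, as a series in \<open>1/z\<close>\<close>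
definition E_infinity :: "(int \<Rightarrow> complex) \<Rightarrow> complex fls" where
  "E_infinity \<nu> = fls_X * fps_to_fls (Abs_fps (\<lambda>k. \<nu> (- int k)))"

text \<open>This determines the double sequence \<open>\<nu>\<close> uniquely.\<close>
definition correspondence_coeffs ::
    "(nat \<Rightarrow> real) \<Rightarrow> (nat \<Rightarrow> real) \<Rightarrow> (int \<Rightarrow> complex) \<Rightarrow> bool" where
  "correspondence_coeffs c d \<nu> \<longleftrightarrow>
     (\<forall>n. fls_order_ge (E_zero \<nu> - rational_expansion (Q c d n) (R c d n) fls_X) n \<and>
          fls_order_ge (E_infinity \<nu> - rational_expansion (Q c d n) (R c d n) fls_X_inv) (n + 1))"

definition measure_support :: "'a::topological_space measure \<Rightarrow> 'a set" where
  "measure_support M =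
     {x \<in> space M. \<forall>U. open U \<longrightarrow> x \<in> U \<longrightarrow> emeasure M (U \<inter> space M) > 0}"

definition nontrivial_prob_measure_on_circle :: "complex measure \<Rightarrow> bool" where
  "nontrivial_prob_measure_on_circle M \<longleftrightarrow>
     prob_space M \<and> space M = sphere 0 1 \<and>
     sets M = sets (restrict_space borel (sphere 0 1)) \<and>
     infinite (measure_support M)"

definition associated_measure ::
    "(nat \<Rightarrow> real) \<Rightarrow> (nat \<Rightarrow> real) \<Rightarrow> complex measure \<Rightarrow> bool" where
  "associated_measure c d M \<longleftrightarrow>
     nontrivial_prob_measure_on_circle M \<and>
     (\<exists>\<nu>. correspondence_coeffs c d \<nu> \<and>
          (\<forall>n::int. (\<integral>\<zeta>. \<zeta> powi (- n) * (1 - \<zeta>) \<partial>M) = \<nu> n))"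

definition monic_OPUC :: "complex measure \<Rightarrow> (nat \<Rightarrow> complex poly) \<Rightarrow> bool" where
  "monic_OPUC M S \<longleftrightarrow>
     (\<forall>n. degree (S n) = n \<and> lead_coeff (S n) = 1) \<and>
     (\<forall>m n. m \<noteq> n \<longrightarrow> (\<integral>\<zeta>. cnj (poly (S m) \<zeta>) * poly (S n) \<zeta> \<partial>M) = 0)"

end

theory Submission
  imports Defs
begin

text \<open>
  Comparing the coefficients of \<open>R\<^sub>n E\<^sub>0 - Q\<^sub>n\<close> and \<open>R\<^sub>n E\<^sub>\<infinity> - Q\<^sub>n\<close> at \<open>z\<^sup>k\<close> for \<open>0 \<le> k < n\<close> eliminates
  \<open>Q\<^sub>n\<close> and shows that \<open>R\<^sub>n\<close> is orthogonal to \<open>\<zeta>, \<dots>, \<zeta>\<^sup>n\<close> with respect to \<open>(1 - \<zeta>) d\<mu>\<close>. Hence the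
  integrals of \<open>\<zeta>\<^sup>-\<^sup>k S\<^sub>n\<close> against \<open>\<mu>\<close>, \<open>0 \<le> k < n\<close>, all coincide, and it remains to see that the one
  with \<open>k = 0\<close> vanishes. Integrating the recurrence of \<open>R\<close> multiplied by \<open>\<zeta>\<^sup>-\<^sup>1\<close>, the same
  orthogonality shows that \<open>a\<^sub>n = \<integral> R\<^sub>n d\<mu>\<close> satisfies \<open>a\<^sub>n\<^sub>+\<^sub>1 = 2 a\<^sub>n - 4 d\<^sub>n\<^sub>+\<^sub>1 a\<^sub>n\<^sub>-\<^sub>1\<close>, which is solved by
  \<open>a\<^sub>n = 2 (1 - m\<^sub>n) a\<^sub>n\<^sub>-\<^sub>1\<close>.
\<close>

section \<open>Series expansions at the origin and at infinity\<close>

lemma fls_nth_poly_X_times: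
  "fls_nth (poly (map_poly fls_const p) fls_X * F) k =
     (\<Sum>j\<le>degree p. coeff p j * fls_nth F (k - int j))" for p :: "'a::field poly"
proof -
  have "poly (map_poly fls_const p) fls_X * F =
      (\<Sum>j\<le>degree p. fls_const (coeff p j) * (fls_X ^ j * F))"
    by (simp add: poly_altdef coeff_map_poly degree_map_poly sum_distrib_right mult.assoc)
  then show ?thesis
    by (simp add: fls_nth_sum fls_X_power_times_conv_shift)
qed

lemma fls_nth_poly_X_inv_times:
  "fls_nth (poly (map_poly fls_const p) fls_X_inv * F) k =
     (\<Sum>j\<le>degree p. coeff p j * fls_nth F (k + int j))" for p :: "'a::field poly"
proof -
  have "poly (map_poly fls_const p) fls_X_inv * F =
      (\<Sum>j\<le>degree p. fls_const (coeff p j) * (fls_X_inv ^ j * F))"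
    by (simp add: poly_altdef coeff_map_poly degree_map_poly sum_distrib_right mult.assoc)
  then show ?thesis
    by (simp add: fls_nth_sum fls_X_inv_power_times_conv_shift)
qed

lemma fls_nth_poly_X:
  "fls_nth (poly (map_poly fls_const p) fls_X) (int k) = coeff p k" for p :: "'a::field poly"
proof -
  have "fls_nth (poly (map_poly fls_const p) fls_X) (int k) =
      (\<Sum>j\<le>degree p. coeff p j * (if j = k then 1 else 0))"
    using fls_nth_poly_X_times[of p 1 "int k"]
    by (simp only: mult_1_right fls_one_nth) (simp add: eq_commute[of k])
  then show ?thesis
    by (simp add: if_distrib[of "(*) _"] coeff_eq_0 cong: if_cong)
qed

lemma fls_nth_poly_X_inv:
  "fls_nth (poly (map_poly fls_const p) fls_X_inv) (- int k) = coeff p k" for p :: "'a::field poly"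
proof -
  have "fls_nth (poly (map_poly fls_const p) fls_X_inv) (- int k) =
      (\<Sum>j\<le>degree p. coeff p j * (if j = k then 1 else 0))"
    using fls_nth_poly_X_inv_times[of p 1 "- int k"]
    by (simp only: mult_1_right fls_one_nth) (simp add: eq_commute[of k])
  then show ?thesis
    by (simp add: if_distrib[of "(*) _"] coeff_eq_0 cong: if_cong)
qed

lemma E_zero_nth: "fls_nth (E_zero \<nu>) k = (if k < 0 then 0 else - \<nu> (k + 1))"
  by (simp add: E_zero_def)

lemma E_infinity_nth: "fls_nth (E_infinity \<nu>) k = (if k \<le> 0 then 0 else \<nu> (1 - k))"
  by (auto simp: E_infinity_def fls_X_times_conv_shift)

text \<open>Multiplication by \<open>p\<close> brings in no negative power of z, so the remainder
  keeps its order and cannot touch the coefficients below \<open>n\<close>.\<close>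

lemma expansion_at_zero:
  assumes "fls_order_ge (E_zero \<nu> - rational_expansion q p fls_X) n" "p \<noteq> 0" "k < n"
  shows "coeff q k = (\<Sum>j\<le>degree p. coeff p j * fls_nth (E_zero \<nu>) (int k - int j))"
proof -
  define D where "D = poly (map_poly fls_const p) (fls_X :: complex fls)"
  define N where "N = poly (map_poly fls_const q) (fls_X :: complex fls)"
  define F where "F = E_zero \<nu> - N / D"
  \<comment> \<open>Cancelling \<open>D\<close> in \<open>D * (N / D)\<close> requires
    \<open>D \<noteq> 0\<close>, as division by zero yields 0; the leading coefficient of
    \<open>p\<close> witnesses this.\<close>
  have "fls_nth D (int (degree p)) \<noteq> 0"
    using assms(2) by (simp add: D_def fls_nth_poly_X)
  then have "D \<noteq> 0" by auto
  then have "N = D * E_zero \<nu> - D * F"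
    by (simp add: F_def algebra_simps)
  moreover have "fls_nth (D * F) (int k) = 0"
    using assms(1,3)
    by (auto simp: D_def fls_nth_poly_X_times F_def N_def fls_order_ge_def rational_expansion_def
        intro!: sum.neutral)
  ultimately have "fls_nth N (int k) = fls_nth (D * E_zero \<nu>) (int k)"
    by simp
  then show ?thesis
    by (simp add: N_def D_def fls_nth_poly_X fls_nth_poly_X_times)
qed

text \<open>In the variable 1/z, z^k sits at index \<open>- k\<close> and \<open>p\<close> has order
  \<open>- degree p\<close>. A remainder of order \<open>degree p + 1\<close> thus stays of positive
  order after multiplication by \<open>p\<close>, which leaves every coefficient of \<open>q\<close>
  exact, with no bound on \<open>k\<close>.\<close>

lemma expansion_at_infinity:
  assumes "fls_order_ge (E_infinity \<nu> - rational_expansion q p fls_X_inv) (Suc (degree p))" "p \<noteq> 0"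
  shows "coeff q k = (\<Sum>j\<le>degree p. coeff p j * fls_nth (E_infinity \<nu>) (int j - int k))"
proof -
  define D where "D = poly (map_poly fls_const p) (fls_X_inv :: complex fls)"
  define N where "N = poly (map_poly fls_const q) (fls_X_inv :: complex fls)"
  define F where "F = E_infinity \<nu> - N / D"
  have "fls_nth D (- int (degree p)) \<noteq> 0"
    using assms(2) by (simp add: D_def fls_nth_poly_X_inv)
  then have "D \<noteq> 0" by auto
  then have "N = D * E_infinity \<nu> - D * F"
    by (simp add: F_def algebra_simps)
  moreover have "fls_nth (D * F) (- int k) = 0"
    using assms(1)
    by (auto simp: D_def fls_nth_poly_X_inv_times F_def N_def fls_order_ge_def
        rational_expansion_def intro!: sum.neutral)
  ultimately have "fls_nth N (- int k) = fls_nth (D * E_infinity \<nu>) (- int k)"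
    by simp
  then show ?thesis
    by (simp add: N_def D_def fls_nth_poly_X_inv fls_nth_poly_X_inv_times)
qed

section \<open>Degree and leading coefficient of \<open>R\<close>\<close>

lemma degree_R_le: "degree (R c d n) \<le> n"
proof (induction n rule: R.induct[of _ c d])
  case (3 c d n)
  have "degree ([:1 - \<i> * of_real (c (n + 2)), 1 + \<i> * of_real (c (n + 2)):] * R c d (Suc n))
      \<le> 1 + Suc n"
    using 3(1) by (intro order.trans[OF degree_mult_le] add_mono) auto
  moreover have "degree ([:0, 4 * complex_of_real (d (n + 2)):] * R c d n) \<le> 1 + n"
    using 3(2) by (intro order.trans[OF degree_mult_le] add_mono) auto
  ultimately show ?case
    by (simp only: R.simps) (intro degree_diff_le; simp)
qed auto

lemma coeff_R: "coeff (R c d n) n = (\<Prod>k=1..n. 1 + \<i> * of_real (c k))"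
proof (induction n rule: R.induct[of _ c d])
  case (3 c d n)
  have "coeff (R c d (Suc n)) (Suc (Suc n)) = 0" "coeff (R c d n) (Suc n) = 0"
    using degree_R_le[of c d "Suc n"] degree_R_le[of c d n] by (auto intro: coeff_eq_0)
  then show ?case
    using 3(1) by (simp add: mult.commute)
qed auto

text \<open>The real part is 1. Hence the leading coefficient of \<open>R c d n\<close> never
  vanishes.\<close>

lemma one_plus_i_times_neq_0: "1 + \<i> * of_real x \<noteq> 0"
  by (simp add: complex_eq_iff)

lemma prod_one_plus_i_neq_0: "(\<Prod>k=1..n. 1 + \<i> * of_real (c k)) \<noteq> 0"
  for c :: "nat \<Rightarrow> real"
  using one_plus_i_times_neq_0 by (auto simp only: prod_zero_iff finite_atLeastAtMost)

lemma degree_R: "degree (R c d n) = n"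
  by (intro antisym degree_R_le le_degree) (simp only: coeff_R prod_one_plus_i_neq_0 not_False_eq_True)

lemma R_neq_0: "R c d n \<noteq> 0"
  using coeff_R[of c d n] prod_one_plus_i_neq_0[of c n] by auto

section \<open>Elimination of \<open>Q\<close> and orthogonality in terms of \<nu>\<close>

lemma correspondence_coeffs_orthogonal:
  assumes "correspondence_coeffs c d \<nu>" "1 \<le> k" "k \<le> n"
  shows "(\<Sum>j\<le>n. coeff (R c d n) j * \<nu> (int k - int j)) = 0"
proof -
  obtain l where l: "k = Suc l" using assms(2) by (cases k) auto
  let ?r = "coeff (R c d n)"
  have "(\<Sum>j\<le>n. ?r j * fls_nth (E_infinity \<nu>) (int j - int l)) =
      (\<Sum>j\<le>n. ?r j * fls_nth (E_zero \<nu>) (int l - int j))"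
    using expansion_at_zero[of \<nu> "Q c d n" "R c d n" n l]
      expansion_at_infinity[of \<nu> "Q c d n" "R c d n" l] assms l
    by (simp add: correspondence_coeffs_def R_neq_0 degree_R)
  then have "(\<Sum>j\<le>n. ?r j * (fls_nth (E_infinity \<nu>) (int j - int l)
      - fls_nth (E_zero \<nu>) (int l - int j))) = 0"
    by (simp add: right_diff_distrib sum_subtractf)
  \<comment> \<open>\<open>E_infinity\<close> starts at index 1 and \<open>E_zero\<close> at index
    0, so only the former contributes for j > l and only the latter for j \<le> l. With k = l + 1
    both give the same formula, without gap or overlap.\<close>
  also have "(\<lambda>j. fls_nth (E_infinity \<nu>) (int j - int l) - fls_nth (E_zero \<nu>) (int l - int j)) =
      (\<lambda>j. \<nu> (int k - int j))"
    by (auto simp: fun_eq_iff E_infinity_nth E_zero_nth l algebra_simps)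
  finally show ?thesis
    by (simp add: fun_eq_iff)
qed

text \<open>Compares the constant terms of Q_1 and R_1 E_\<infinity>. It supplies the initial value
  of the recurrence for the integrals of R_n.\<close>

lemma correspondence_coeffs_0:
  assumes "correspondence_coeffs c d \<nu>"
  shows "(1 + \<i> * of_real (c 1)) * \<nu> 0 = 2 * of_real (d 1)"
proof -
  have "fls_order_ge (E_infinity \<nu> - rational_expansion (Q c d 1) (R c d 1) fls_X_inv)
      (Suc (degree (R c d 1)))"
    using assms unfolding correspondence_coeffs_def degree_R by (metis Suc_eq_plus1)
  then have "coeff (Q c d 1) 0 =
      (\<Sum>j\<le>1. coeff (R c d 1) j * fls_nth (E_infinity \<nu>) (int j - int 0))"
    using expansion_at_infinity[OF _ R_neq_0, of \<nu> "Q c d 1" c d 1 0] unfolding degree_R by blast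
  then show ?thesis
    by (simp add: E_infinity_nth)
qed

section \<open>Integrals over the unit circle\<close>

definition power_moment :: "complex measure \<Rightarrow> int \<Rightarrow> complex poly \<Rightarrow> complex" where
  "power_moment M k p = (\<integral>\<zeta>. \<zeta> powi k * poly p \<zeta> \<partial>M)"

locale circle_measure =
  fixes M :: "complex measure"
  assumes prob: "prob_space M"
    and space_eq: "space M = sphere 0 1"
    and sets_eq: "sets M = sets (restrict_space borel (sphere 0 1))"
begin

lemma integrable_continuous:
  fixes f :: "complex \<Rightarrow> complex"
  assumes "continuous_on (sphere 0 1) f"
  shows "integrable M f"
proof -
  interpret prob_space M by (rule prob)
  have "compact (f ` sphere 0 1)"
    using assms by (intro compact_continuous_image) auto
  then obtain B where B: "\<forall>x\<in>f ` sphere 0 1. norm x \<le> B"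
    using compact_imp_bounded bounded_iff by metis
  have "f \<in> borel_measurable M"
    using borel_measurable_continuous_on_restrict[OF assms]
      measurable_cong_sets[OF sets_eq refl] by blast
  then show ?thesis
    using B space_eq by (intro integrable_const_bound[of _ B]) auto
qed

lemma integrable_powi_poly: "integrable M (\<lambda>\<zeta>. \<zeta> powi k * poly p \<zeta>)"
  by (intro integrable_continuous continuous_intros) auto

lemma power_moment_diff: "power_moment M k (p - q) = power_moment M k p - power_moment M k q"
  using integrable_powi_poly by (simp add: power_moment_def right_diff_distrib)

lemma power_moment_add: "power_moment M k (p + q) = power_moment M k p + power_moment M k q"
  using integrable_powi_poly by (simp add: power_moment_def distrib_left)

lemma power_moment_smult: "power_moment M k (smult a p) = a * power_moment M k p"
  by (simp add: power_moment_def mult.left_commute)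

lemma power_moment_pCons_0: "power_moment M k (pCons 0 p) = power_moment M (k + 1) p"
  unfolding power_moment_def
proof (rule Bochner_Integration.integral_cong)
  fix \<zeta> assume "\<zeta> \<in> space M"
  then have "\<zeta> \<noteq> 0" by (auto simp: space_eq)
  then show "\<zeta> powi k * poly (pCons 0 p) \<zeta> = \<zeta> powi (k + 1) * poly p \<zeta>"
    by (simp add: power_int_add mult_ac)
qed simp

lemma power_moment_linear_times:
  "power_moment M k ([:a, b:] * p) = a * power_moment M k p + b * power_moment M (k + 1) p"
proof -
  have "[:a, b:] * p = smult a p + smult b (pCons 0 p)"
    by simp
  then show ?thesis
    by (simp only: power_moment_add power_moment_smult power_moment_pCons_0)
qed

lemma power_moment_0_1: "power_moment M 0 1 = 1"
  using prob_space.prob_space[OF prob] by (simp add: power_moment_def)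

text \<open>On the circle conjugation is inversion, so inner products reduce to moments with
  nonpositive exponents.\<close>

lemma integral_cnj_poly_times:
  "(\<integral>\<zeta>. cnj (poly q \<zeta>) * poly p \<zeta> \<partial>M) =
     (\<Sum>k\<le>degree q. cnj (coeff q k) * power_moment M (- int k) p)"
proof -
  have "(\<integral>\<zeta>. cnj (poly q \<zeta>) * poly p \<zeta> \<partial>M) =
      (\<integral>\<zeta>. (\<Sum>k\<le>degree q. cnj (coeff q k) * (\<zeta> powi (- int k) * poly p \<zeta>)) \<partial>M)"
  proof (rule Bochner_Integration.integral_cong)
    fix \<zeta> assume "\<zeta> \<in> space M"
    then have n: "norm \<zeta> = 1" by (auto simp: space_eq)
    then have "cnj \<zeta> = inverse \<zeta>"
      using complex_norm_square[of \<zeta>] by (intro inverse_unique[symmetric]) simp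
    then show "cnj (poly q \<zeta>) * poly p \<zeta> =
        (\<Sum>k\<le>degree q. cnj (coeff q k) * (\<zeta> powi (- int k) * poly p \<zeta>))"
      by (simp add: poly_altdef[of q] sum_distrib_right power_int_minus power_inverse mult.assoc)
  qed simp
  then show ?thesis
    using integrable_powi_poly by (simp add: power_moment_def)
qed

text \<open>Passes from \<mu> to (1 - \<zeta>) d\<mu>, the only measure for which the numbers \<nu>
  give direct information.\<close>

lemma power_moment_step:
  "power_moment M k p - power_moment M (k + 1) p =
     (\<Sum>j\<le>degree p. coeff p j * (\<integral>\<zeta>. \<zeta> powi (k + int j) * (1 - \<zeta>) \<partial>M))"
proof -
  have "power_moment M k p - power_moment M (k + 1) p =
      (\<integral>\<zeta>. \<zeta> powi k * poly p \<zeta> - \<zeta> powi (k + 1) * poly p \<zeta> \<partial>M)"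
    using integrable_powi_poly by (simp add: power_moment_def)
  also have "\<dots> =
      (\<integral>\<zeta>. (\<Sum>j\<le>degree p. coeff p j * (\<zeta> powi (k + int j) * (1 - \<zeta>))) \<partial>M)"
  proof (rule Bochner_Integration.integral_cong)
    fix \<zeta> assume "\<zeta> \<in> space M"
    then have "\<zeta> \<noteq> 0" by (auto simp: space_eq)
    then show "\<zeta> powi k * poly p \<zeta> - \<zeta> powi (k + 1) * poly p \<zeta> =
        (\<Sum>j\<le>degree p. coeff p j * (\<zeta> powi (k + int j) * (1 - \<zeta>)))"
      by (simp add: poly_altdef power_int_add sum_distrib_left sum_subtractf[symmetric] algebra_simps)
  qed simp
  also have "\<dots> = (\<Sum>j\<le>degree p. coeff p j * (\<integral>\<zeta>. \<zeta> powi (k + int j) * (1 - \<zeta>) \<partial>M))"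
  proof -
    have "integrable M (\<lambda>\<zeta>. \<zeta> powi (k + int j) * (1 - \<zeta>))" for j
      by (intro integrable_continuous continuous_intros) auto
    then show ?thesis by simp
  qed
  finally show ?thesis .
qed

text \<open>For m < n, \<open>S m\<close> involves only powers below n; the case m > n follows by
  conjugation.\<close>

lemma monic_OPUC_I:
  assumes "\<And>n. degree (S n) = n" "\<And>n. lead_coeff (S n) = 1"
    and orth: "\<And>n k. k < n \<Longrightarrow> power_moment M (- int k) (S n) = 0"
  shows "monic_OPUC M S"
proof -
  have lt: "(\<integral>\<zeta>. cnj (poly (S m) \<zeta>) * poly (S n) \<zeta> \<partial>M) = 0" if "m < n" for m n
    using that assms(1) by (simp add: integral_cnj_poly_times orth)
  have gt: "(\<integral>\<zeta>. cnj (poly (S n) \<zeta>) * poly (S m) \<zeta> \<partial>M) = 0" if "m < n" for m n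
  proof -
    have "(\<integral>\<zeta>. cnj (poly (S n) \<zeta>) * poly (S m) \<zeta> \<partial>M) =
        (\<integral>\<zeta>. cnj (cnj (poly (S m) \<zeta>) * poly (S n) \<zeta>) \<partial>M)"
      by (simp add: mult.commute)
    also have "\<dots> = cnj (\<integral>\<zeta>. cnj (poly (S m) \<zeta>) * poly (S n) \<zeta> \<partial>M)"
      by (rule Bochner_Integration.integral_cnj)
    finally show ?thesis
      using lt[OF that] by simp
  qed
  show ?thesis
    unfolding monic_OPUC_def using assms(1,2) lt gt by (metis linorder_neqE_nat)
qed

section \<open>Moments of R_n with respect to \<mu>\<close>

context
  fixes c d :: "nat \<Rightarrow> real" and \<nu> :: "int \<Rightarrow> complex"
  assumes corr: "correspondence_coeffs c d \<nu>"
    and moments: "\<And>n::int. (\<integral>\<zeta>. \<zeta> powi (- n) * (1 - \<zeta>) \<partial>M) = \<nu> n"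
begin

text \<open>The difference is the sum annihilated by
  \<open>correspondence_coeffs_orthogonal\<close>. Iterated, it equates the moments of R_n at
  exponents 0, -1, ..., -n.\<close>

lemma power_moment_R_shift:
  assumes "k < n"
  shows "power_moment M (- int (Suc k)) (R c d n) = power_moment M (- int k) (R c d n)"
proof -
  have "(\<integral>\<zeta>. \<zeta> powi (- int (Suc k) + int j) * (1 - \<zeta>) \<partial>M) = \<nu> (int (Suc k) - int j)" for j
    using moments[of "int (Suc k) - int j"] by (simp add: algebra_simps)
  then have "power_moment M (- int (Suc k)) (R c d n) - power_moment M (- int (Suc k) + 1) (R c d n)
      = (\<Sum>j\<le>n. coeff (R c d n) j * \<nu> (int (Suc k) - int j))"
    unfolding power_moment_step degree_R by simp
  also have "\<dots> = 0"
    using assms by (intro correspondence_coeffs_orthogonal[OF corr]) auto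
  finally show ?thesis
    by simp
qed

lemma power_moment_R:
  assumes "parameter_sequence d m" "m 0 = 0"
  shows "power_moment M 0 (R c d n) = 2 ^ n * (\<Prod>k=1..n. 1 - of_real (m k))"
proof (induction n rule: induct_nat_012)
  case 0
  show ?case by (simp add: power_moment_0_1)
next
  case 1
  \<comment> \<open>Minimality enters here: a parameter sequence with g_0 > 0 would not match the
    initial value 2 - 2 d_1.\<close>
  have d1: "d 1 = m 1"
    using assms by (auto simp: parameter_sequence_def)
  have "1 - power_moment M 1 1 = \<nu> 0"
    using moments[of 0] power_moment_step[of 0 1] power_moment_0_1 by simp
  then have "(1 + \<i> * of_real (c 1)) * (1 - power_moment M 1 1) = 2 * of_real (m 1)"
    using correspondence_coeffs_0[OF corr] d1 by simp
  moreover have "power_moment M 0 (R c d (Suc 0)) =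
      1 - \<i> * of_real (c 1) + (1 + \<i> * of_real (c 1)) * power_moment M 1 1"
    using power_moment_linear_times[of 0 "1 - \<i> * of_real (c 1)" "1 + \<i> * of_real (c 1)" 1]
      power_moment_0_1
    by simp
  then have "power_moment M 0 (R c d (Suc 0)) =
      2 - (1 + \<i> * of_real (c 1)) * (1 - power_moment M 1 1)"
    by (simp add: algebra_simps)
  ultimately show ?case
    by simp
next
  case (ge2 n)
  have "d (n + 2) = (1 - m (Suc n)) * m (n + 2)"
    using assms by (auto simp: parameter_sequence_def)
  moreover have "power_moment M (-1) (R c d (Suc n)) = power_moment M 0 (R c d (Suc n))"
    using power_moment_R_shift[of 0 "Suc n"] by simp
  moreover have "power_moment M 0 (R c d (Suc (Suc n))) = power_moment M (-1) (R c d (Suc (Suc n)))"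
    using power_moment_R_shift[of 0 "Suc (Suc n)"] by simp
  moreover have "R c d (Suc (Suc n)) =
      [:1 - \<i> * of_real (c (n + 2)), 1 + \<i> * of_real (c (n + 2)):] * R c d (Suc n)
      - [:0, 4 * of_real (d (n + 2)):] * R c d n"
    by (rule R.simps)
  \<comment> \<open>At exponent -1 the recurrence involves only exponents -1 and 0, which the shift
    identifies for R_(n+1) and R_(n+2). Then (1 - ic) + (1 + ic) = 2 removes c.\<close>
  then have "power_moment M (-1) (R c d (Suc (Suc n))) =
      (1 - \<i> * of_real (c (n + 2))) * power_moment M (-1) (R c d (Suc n))
      + (1 + \<i> * of_real (c (n + 2))) * power_moment M 0 (R c d (Suc n))
      - 4 * of_real (d (n + 2)) * power_moment M 0 (R c d n)"
    by (simp only: power_moment_diff power_moment_linear_times) simp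
  ultimately have "power_moment M 0 (R c d (Suc (Suc n))) =
      2 * power_moment M 0 (R c d (Suc n))
      - 4 * of_real ((1 - m (Suc n)) * m (n + 2)) * power_moment M 0 (R c d n)"
    by (simp add: left_diff_distrib distrib_right del: R.simps)
  \<comment> \<open>By induction 2 (1 - m_(n+1)) a_n = a_(n+1), so the right side becomes 2 a_(n+1)
    (1 - m_(n+2)).\<close>
  then show ?case
    unfolding ge2 by (simp add: algebra_simps)
qed

lemma power_moment_R_combination:
  assumes "parameter_sequence d m" "m 0 = 0" "k < n"
  shows "power_moment M (- int k)
     (R c d n - smult (2 * (1 - of_real (m n))) (R c d (n - 1))) = 0"
  using \<open>k < n\<close>
proof (induction k)
  case 0
  then obtain l where "n = Suc l" by (cases n) auto
  then show ?case
    using power_moment_R[OF assms(1,2)]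
    by (simp add: power_moment_diff power_moment_smult)
next
  \<comment> \<open>\<open>Suc k < n\<close> gives k < n - 1, so the shift applies to R_(n-1) too;
    its shorter range stops at exponent -(n - 1), just what is needed.\<close>
  case (Suc k)
  then show ?case
    using power_moment_R_shift[of k n] power_moment_R_shift[of k "n - 1"]
    by (simp only: power_moment_diff power_moment_smult)
qed

end

end

theorem theorem5p2:
  fixes c d m :: "nat \<Rightarrow> real"
    and \<mu> :: "complex measure"
    and S :: "nat \<Rightarrow> complex poly"
  assumes "positive_chain_sequence d"
    and "minimal_parameter_sequence d m"
    and "associated_measure c d \<mu>"
    and "S 0 = 1"
    and "\<And>n. n \<ge> 1 \<Longrightarrow>
           smult (\<Prod>k=1..n. 1 + \<i> * of_real (c k)) (S n)
           = R c d n - smult (2 * (1 - of_real (m n))) (R c d (n - 1))"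
  shows "monic_OPUC \<mu> S"
proof -
  interpret circle_measure \<mu>
    using assms(3)
    unfolding associated_measure_def nontrivial_prob_measure_on_circle_def
    by (blast intro: circle_measure.intro)
  obtain \<nu> where \<nu>: "correspondence_coeffs c d \<nu>"
      "\<And>n::int. (\<integral>\<zeta>. \<zeta> powi (- n) * (1 - \<zeta>) \<partial>\<mu>) = \<nu> n"
    using assms(3) unfolding associated_measure_def by blast
  let ?P = "\<lambda>n. \<Prod>k=1..n. 1 + \<i> * complex_of_real (c k)"
  \<comment> \<open>R_(n-1) does not reach z^n, so for n \<ge> 1 the right side has the leading
    coefficient of R_n, which is exactly the nonzero factor attached to \<open>S n\<close>.\<close>
  have deg_coeff: "degree (S n) = n \<and> coeff (S n) n = 1" for n
  proof (cases n)
    case 0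
    then show ?thesis using assms(4) by simp
  next
    case (Suc l)
    let ?T = "R c d n - smult (2 * (1 - of_real (m n))) (R c d l)"
    have S: "smult (?P n) (S n) = ?T"
      using assms(5)[of n] Suc by simp
    have "coeff (R c d l) n = 0"
      using Suc by (intro coeff_eq_0) (simp add: degree_R)
    then have cT: "coeff ?T n = ?P n"
      by (simp only: coeff_diff coeff_smult coeff_R mult_zero_right diff_zero)
    have "degree ?T \<le> n"
      using Suc degree_R_le
      by (intro degree_diff_le order.trans[OF degree_smult_le]) (simp_all add: degree_R)
    moreover have "coeff (S n) n = 1"
      using arg_cong[OF S, of "\<lambda>p. coeff p n"] cT prod_one_plus_i_neq_0[of c n] by simp
    ultimately show ?thesis
      using arg_cong[OF S, of degree] le_degree[of "S n" n] prod_one_plus_i_neq_0[of c n] by simp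
  qed
  show ?thesis
  proof (rule monic_OPUC_I)
    fix n k :: nat
    assume "k < n"
    then have "power_moment \<mu> (- int k) (smult (?P n) (S n)) = 0"
      using power_moment_R_combination[OF \<nu>, of m k n] assms(2) assms(5)[of n]
      by (simp add: minimal_parameter_sequence_def)
    then show "power_moment \<mu> (- int k) (S n) = 0"
      using prod_one_plus_i_neq_0[of c n] by (simp add: power_moment_smult)
  qed (use deg_coeff in auto)
qed

end
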